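(* Let $v$ be a sampling vector. Assume that the interpolation condition holds at $x^*\in\mathcal{X}^*$ and that each $f_i$ is $\zeta$-quasar-convex with respect to $x^*$ and $L_i$-smooth. Then SGD with the stochastic Polyak step-size (SPS) with constant $c>\frac{1}{2\zeta}$ satisfies, for every $K\ge1$, $$\min_{i=0,\dots,K-1}\mathbb{E}[f(x^i)-f^*]\le\frac{2c^2}{2c\zeta-1}\,\frac{\mathcal{L}_{\max}}{K}\,\|x^0-x^*\|^2,$$ where $\mathcal{L}_{\max}>0$ is a constant such that, for all $x\in\mathbb{R}^d$, $$\frac{1}{2\mathcal{L}_{\max}}(f(x)-f^* )\le\mathbb{E}\left[\frac{(f_v(x)-f_v^* )^2}{\|\nabla f_v(x)\|^2}\right].$$
   Context: $f_1,\dots,f_n:\mathbb{R}^d\to\mathbb{R}$ are differentiable, $f=\frac1n\sum_if_i$ has a nonempty set $\mathcal{X}^*$ of global minimizers, $f^*=\min f$. A sampling vector is a random vector $v\in\mathbb{R}^n$ with nonnegative entries and $\mathbb{E}[v_i]=1$ for all $i$; $f_v=\frac1n\sum_iv_if_i$, $f_v^*=\min_xf_v(x)$. SGD with SPS from a deterministic $x^0$: $x^{k+1}=x^k-\gamma_k\nabla f_{v^k}(x^k)$, with $v^0,v^1,\dots$ i.i.d. copies of $v$ and $$\gamma_k=\frac{f_{v^k}(x^k)-f_{v^k}^*}{c\,\|\nabla f_{v^k}(x^k)\|^2}.$$ Convention: when $\nabla f_v(x)=0$ (in which case, under the hypotheses, $f_v(x)=f_v^*$) the step is zero and the ratio $(f_v(x)-f_v^*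 )^2/\|\nabla f_v(x)\|^2$ is $0$. Interpolation at $x^*$: $f_i(x^* )=\min_xf_i(x)$ for all $i$. $f_i$ is $L_i$-smooth if $f_i(z)-f_i(x)\le\langle\nabla f_i(x),z-x\rangle+\frac{L_i}2\|z-x\|^2$ for all $x,z$. For $\zeta\in(0,1]$, $h$ is $\zeta$-quasar-convex with respect to $x^*$ if $h(x^* )\ge h(x)+\frac1\zeta\langle\nabla h(x),x^*-x\rangle$ for all $x$. *)

theory Defs
  imports "HOL-Probability.Probability"
begin

definition gradient :: "('a::real_inner \<Rightarrow> real) \<Rightarrow> 'a \<Rightarrow> 'a" where
  "gradient h x = (THE D. GDERIV h x :> D)"

definition global_minimizers :: "('a \<Rightarrow> real) \<Rightarrow> 'a set" where
  "global_minimizers h = {x. \<forall>y. h x \<le> h y}"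

text \<open>The infimum is the minimum whenever \<open>global_minimizers h\<close> is nonempty, which is the only
  case in which its value is used (almost surely).\<close>

definition min_value :: "('a \<Rightarrow> real) \<Rightarrow> real" where
  "min_value h = (INF x. h x)"

definition average :: "('n::finite \<Rightarrow> 'a \<Rightarrow> real) \<Rightarrow> 'a \<Rightarrow> real" where
  "average f x = (1 / real CARD('n)) * (\<Sum>i\<in>UNIV. f i x)"

definition weighted_average :: "('n::finite \<Rightarrow> 'a \<Rightarrow> real) \<Rightarrow> real ^ 'n \<Rightarrow> 'a \<Rightarrow> real" where
  "weighted_average f w x = (1 / real CARD('n)) * (\<Sum>i\<in>UNIV. (w $ i) * f i x)"

definition sampling_vector :: "'w measure \<Rightarrow> ('w \<Rightarrow> real ^ 'n::finite) \<Rightarrow> bool" where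
  "sampling_vector N v \<longleftrightarrow>
     prob_space N \<and> v \<in> borel_measurable N \<and>
     (AE \<omega> in N. \<forall>i. 0 \<le> v \<omega> $ i) \<and>
     (\<forall>i. integrable N (\<lambda>\<omega>. v \<omega> $ i) \<and> (\<integral>\<omega>. v \<omega> $ i \<partial>N) = 1)"

definition interpolation_at :: "('n \<Rightarrow> 'a \<Rightarrow> real) \<Rightarrow> 'a \<Rightarrow> bool" where
  "interpolation_at f xs \<longleftrightarrow> (\<forall>i. xs \<in> global_minimizers (f i))"

definition smooth_const :: "real \<Rightarrow> ('a::real_inner \<Rightarrow> real) \<Rightarrow> bool" where
  "smooth_const L h \<longleftrightarrow>
     (\<forall>x z. h z - h x \<le> gradient h x \<bullet> (z - x) + L / 2 * (norm (z - x))\<^sup>2)"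

definition quasar_convex :: "real \<Rightarrow> 'a \<Rightarrow> ('a::real_inner \<Rightarrow> real) \<Rightarrow> bool" where
  "quasar_convex \<zeta> xs h \<longleftrightarrow>
     (\<forall>x. h xs \<ge> h x + (1 / \<zeta>) * (gradient h x \<bullet> (xs - x)))"

text \<open>Since division by zero yields zero, \<open>sps_stepsize\<close> and \<open>sps_ratio\<close> are zero
  when the gradient vanishes.\<close>

definition sps_stepsize ::
    "('n::finite \<Rightarrow> 'a::real_inner \<Rightarrow> real) \<Rightarrow> real \<Rightarrow> real ^ 'n \<Rightarrow> 'a \<Rightarrow> real" where
  "sps_stepsize f c w x =
     (weighted_average f w x - min_value (weighted_average f w)) /
     (c * (norm (gradient (weighted_average f w) x))\<^sup>2)"

definition sps_ratio ::
    "('n::finite \<Rightarrow> 'a::real_inner \<Rightarrow> real) \<Rightarrow> real ^ 'n \<Rightarrow> 'a \<Rightarrow> real" where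
  "sps_ratio f w x =
     (weighted_average f w x - min_value (weighted_average f w))\<^sup>2 /
     (norm (gradient (weighted_average f w) x))\<^sup>2"

text \<open>The iterates along one realization \<open>w\<close> of the sequence of sampling vectors.\<close>

primrec sgd_sps ::
    "('n::finite \<Rightarrow> 'a::real_inner \<Rightarrow> real) \<Rightarrow> real \<Rightarrow> 'a \<Rightarrow> (nat \<Rightarrow> real ^ 'n) \<Rightarrow> nat \<Rightarrow> 'a" where
  "sgd_sps f c x0 w 0 = x0"
| "sgd_sps f c x0 w (Suc k) =
     (let x = sgd_sps f c x0 w k
      in x - sps_stepsize f c (w k) x *\<^sub>R gradient (weighted_average f (w k)) x)"

definition iid_copies ::
    "'w measure \<Rightarrow> (nat \<Rightarrow> 'w \<Rightarrow> 'b::topological_space) \<Rightarrow> 'u measure \<Rightarrow> ('u \<Rightarrow> 'b) \<Rightarrow> bool" where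
  "iid_copies M V N v \<longleftrightarrow>
     prob_space M \<and> prob_space.indep_vars M (\<lambda>_. borel) V UNIV \<and>
     (\<forall>k. distr M borel (V k) = distr N borel v)"

end

theory Submission
  imports Defs
begin

text \<open>
  Interpolation makes \<open>xs\<close> a minimizer of every \<open>f\<^sub>w\<close> with nonnegative weights, and quasar-convexity
  with respect to \<open>xs\<close> passes from the \<open>f i\<close> to \<open>f\<^sub>w\<close>. Expanding the square, one step of SGD with SPS
  therefore lowers the squared distance to \<open>xs\<close> by at least \<open>(2 * c * \<zeta> - 1) / c\<^sup>2\<close> times the ratio
  \<open>(f\<^sub>w x - min f\<^sub>w)\<^sup>2 / (norm (gradient f\<^sub>w x))\<^sup>2\<close>, almost surely. Since the \<open>k\<close>-th iterate is independent of
  the \<open>k\<close>-th sample, Fubini and the defining property of \<open>Lmax\<close> bound the expected ratio from below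
  by the expected suboptimality, and telescoping gives the rate. As the iterates stay in a fixed
  ball almost surely, all expectations are finite.
\<close>

section \<open>Gradients of differentiable functions and their Borel measurability\<close>

lemma gradient_eqI: "GDERIV h x :> D \<Longrightarrow> gradient h x = D"
  unfolding gradient_def gderiv_def
  by (rule the_equality) (auto dest: has_derivative_unique simp: fun_eq_iff vector_eq_ldot)

text \<open>Riesz representation in finite dimension: the vector whose coordinates are the values of
  the derivative on an orthonormal basis represents it. This gives the description in
  \<open>gradient\<close> its intended meaning.\<close>

lemma GDERIV_gradient:
  fixes h :: "'a::euclidean_space \<Rightarrow> real"
  assumes "h differentiable (at x)"
  shows "GDERIV h x :> gradient h x"
proof -
  obtain h' where h': "(h has_derivative h') (at x)"
    using assms by (auto simp: differentiable_def)
  interpret bounded_linear h' by (rule has_derivative_bounded_linear[OF h'])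
  define D where "D = (\<Sum>b\<in>Basis. h' b *\<^sub>R b)"
  have "h' y = y \<bullet> D" for y
  proof -
    have "h' y = h' (\<Sum>b\<in>Basis. (y \<bullet> b) *\<^sub>R b)" by (simp add: euclidean_representation)
    also have "\<dots> = y \<bullet> D"
      by (simp add: D_def sum scaleR inner_sum_right mult.commute)
    finally show ?thesis .
  qed
  then have "h' = (\<lambda>y. y \<bullet> D)" by (rule ext)
  then have "GDERIV h x :> D"
    using h' by (simp add: gderiv_def)
  then show ?thesis by (simp add: gradient_eqI)
qed

text \<open>Differentiability does not make the gradient continuous, so its measurability is
  obtained through a countable limit: each component is a pointwise limit of difference quotients,
  which are Borel in \<open>x\<close>.\<close>

lemma gradient_inner_LIMSEQ:
  fixes h :: "'a::euclidean_space \<Rightarrow> real"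
  assumes "h differentiable (at x)"
  shows "(\<lambda>n. real (Suc n) * (h (x + inverse (real (Suc n)) *\<^sub>R b) - h x)) \<longlonglongrightarrow> gradient h x \<bullet> b"
proof -
  \<comment> \<open>Writing the base point as the line at parameter 0 lets the chain rule
    apply.\<close>
  have h': "(h has_derivative (\<lambda>y. y \<bullet> gradient h x)) (at (x + 0 *\<^sub>R b))"
    using GDERIV_gradient[OF assms] by (simp add: gderiv_def)
  have "((\<lambda>t. h (x + t *\<^sub>R b)) has_derivative (\<lambda>t. (t *\<^sub>R b) \<bullet> gradient h x)) (at 0)"
  proof (rule has_derivative_compose[where f = "\<lambda>t. x + t *\<^sub>R b" and x = 0 and s = UNIV, OF _ h'])
    show "((\<lambda>t. x + t *\<^sub>R b) has_derivative (\<lambda>t. t *\<^sub>R b)) (at 0)"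
      by (auto intro!: derivative_eq_intros)
  qed
  then have "((\<lambda>t. h (x + t *\<^sub>R b)) has_real_derivative gradient h x \<bullet> b) (at 0)"
    by (rule has_derivative_imp_has_field_derivative) (simp add: inner_commute)
  then have "(\<lambda>t. (h (x + t *\<^sub>R b) - h x) / t) \<midarrow>0\<rightarrow> gradient h x \<bullet> b"
    by (simp add: DERIV_def)
  moreover have "filterlim (\<lambda>n. inverse (real (Suc n))) (at 0) sequentially"
    using LIMSEQ_inverse_real_of_nat by (auto simp: filterlim_at)
  ultimately have "(\<lambda>n. (h (x + inverse (real (Suc n)) *\<^sub>R b) - h x) / inverse (real (Suc n)))
      \<longlonglongrightarrow> gradient h x \<bullet> b"
    by (rule filterlim_compose)
  then show ?thesis by (simp add: field_simps)
qed

lemma borel_measurable_gradient: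
  fixes h :: "'a::euclidean_space \<Rightarrow> real"
  assumes "\<And>x. h differentiable (at x)"
  shows "gradient h \<in> borel_measurable borel"
proof (subst borel_measurable_euclidean_space, intro ballI)
  fix b :: 'a
  have [measurable]: "h \<in> borel_measurable borel"
    using assms by (intro borel_measurable_continuous_onI)
      (simp add: continuous_on_eq_continuous_within differentiable_imp_continuous_within)
  show "(\<lambda>x. gradient h x \<bullet> b) \<in> borel_measurable borel"
    by (rule borel_measurable_LIMSEQ_real[OF gradient_inner_LIMSEQ[OF assms]]) measurable
qed

section \<open>The infimum as a value and as a measurable function of a parameter\<close>

lemma min_value_eq: "xs \<in> global_minimizers h \<Longrightarrow> min_value h = h xs"
  unfolding min_value_def global_minimizers_def by (intro cInf_eq_minimum) auto

text \<open>On the null set of weights for which \<open>g w\<close> is unbounded below, its infimum is a junk constant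
  independent of \<open>w\<close>, so measurability still holds there.\<close>

lemma borel_measurable_min_value:
  fixes g :: "'b::topological_space \<Rightarrow> 'a \<Rightarrow> real"
  assumes cont: "\<And>x. continuous_on UNIV (\<lambda>w. g w x)"
  shows "(\<lambda>w. min_value (g w)) \<in> borel_measurable borel"
proof (subst borel_measurable_iff_ge, intro allI)
  fix a :: real
  \<comment> \<open>The infimum runs over an uncountable set, but each superlevel set is an
    intersection of closed sets and hence closed. Boundedness below is then a countable union of
    such sets.\<close>
  define S where "S a = {w. \<forall>x. a \<le> g w x}" for a
  define J where "J = (THE x::real. False)"
  have "closed (S a)" for a
    unfolding S_def by (intro closed_Collect_all closed_Collect_le continuous_on_const cont)
  then have [measurable]: "S a \<in> sets borel" for a by (rule borel_closed)
  have bdd: "bdd_below (range (g w)) \<longleftrightarrow> w \<in> (\<Union>n. S (- real n))" for w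
  proof
    assume "bdd_below (range (g w))"
    then obtain m where m: "\<And>x. m \<le> g w x" by (auto simp: bdd_below_def)
    obtain n where "- m \<le> real n" using real_arch_simple by blast
    then have "w \<in> S (- real n)" unfolding S_def using m by (smt (verit) mem_Collect_eq)
    then show "w \<in> (\<Union>n. S (- real n))" by blast
  qed (auto simp: S_def bdd_below_def)
  have ge: "a \<le> min_value (g w) \<longleftrightarrow> w \<in> S a" if "bdd_below (range (g w))" for w
    using that unfolding min_value_def S_def by (auto simp: le_cINF_iff)
  \<comment> \<open>A real \<open>Inf\<close> is the negated \<open>Sup\<close> of the negated set,
    and \<open>Sup\<close> is the least upper bound. Without upper bounds that description has the
    constantly false predicate, whatever \<open>w\<close> is.\<close>
  have junk: "min_value (g w) = - J" if "\<not> bdd_below (range (g w))" for w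
  proof -
    have "\<not> bdd_above (uminus ` range (g w))" using that by simp
    then have "(\<lambda>z. \<forall>x\<in>uminus ` range (g w). x \<le> z) = (\<lambda>z. False)"
      by (auto simp: bdd_above_def fun_eq_iff)
    then show ?thesis
      by (simp add: min_value_def Inf_real_def Sup_real_def J_def Least_def)
  qed
  have "a \<le> min_value (g w) \<longleftrightarrow>
      w \<in> (\<Union>n. S (- real n)) \<inter> S a \<union> (if a \<le> - J then - (\<Union>n. S (- real n)) else {})" for w
    using bdd[of w] ge[of w] junk[of w] by (cases "bdd_below (range (g w))") auto
  then have "{w \<in> space borel. a \<le> min_value (g w)} =
      (\<Union>n. S (- real n)) \<inter> S a \<union> (if a \<le> - J then - (\<Union>n. S (- real n)) else {})"
    by (simp add: set_eq_iff)
  also have "\<dots> \<in> sets borel"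
    by (cases "a \<le> - J") (simp_all add: borel_comp sets.Un sets.Int sets.countable_UN)
  finally show "{w \<in> space borel. a \<le> min_value (g w)} \<in> sets borel" .
qed

section \<open>Weighted averages: gradient, minimizer and quasar-convexity\<close>

lemma GDERIV_weighted_average:
  fixes f :: "'n::finite \<Rightarrow> 'a::euclidean_space \<Rightarrow> real"
  assumes "\<And>i. f i differentiable (at x)"
  shows "GDERIV (weighted_average f w) x :> (1 / real CARD('n)) *\<^sub>R (\<Sum>i\<in>UNIV. w $ i *\<^sub>R gradient (f i) x)"
proof -
  have "(f i has_derivative (\<lambda>y. y \<bullet> gradient (f i) x)) (at x)" for i
    using GDERIV_gradient[OF assms] by (simp add: gderiv_def)
  then show ?thesis
    unfolding gderiv_def weighted_average_def
    by (auto intro!: derivative_eq_intros simp: inner_sum_right)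
qed

lemmas gradient_weighted_average = gradient_eqI[OF GDERIV_weighted_average]

lemma minimizer_weighted_average:
  assumes "interpolation_at f xs" "\<And>i. 0 \<le> w $ i"
  shows "xs \<in> global_minimizers (weighted_average f w)"
  using assms unfolding interpolation_at_def global_minimizers_def weighted_average_def
  by (auto intro!: divide_right_mono sum_mono mult_left_mono)

text \<open>For fixed \<open>\<zeta>\<close> and \<open>xs\<close> the defining inequality is linear
  in the function and its gradient, so nonnegative combinations preserve it.\<close>

lemma quasar_convex_weighted_average:
  fixes f :: "'n::finite \<Rightarrow> 'a::euclidean_space \<Rightarrow> real"
  assumes "\<And>i x. f i differentiable (at x)" "\<And>i. quasar_convex \<zeta> xs (f i)" "\<And>i. 0 \<le> w $ i"
  shows "quasar_convex \<zeta> xs (weighted_average f w)"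
  unfolding quasar_convex_def
proof
  fix x
  let ?n = "real CARD('n)"
  have "weighted_average f w x + 1 / \<zeta> * (gradient (weighted_average f w) x \<bullet> (xs - x)) =
      1 / ?n * (\<Sum>i\<in>UNIV. w $ i * (f i x + 1 / \<zeta> * (gradient (f i) x \<bullet> (xs - x))))"
    unfolding gradient_weighted_average[OF assms(1)] weighted_average_def
    by (simp add: inner_sum_left sum.distrib distrib_left sum_distrib_left sum_divide_distrib mult_ac)
  also have "\<dots> \<le> weighted_average f w xs"
    unfolding weighted_average_def using assms(2,3)
    by (intro mult_left_mono sum_mono) (auto simp: quasar_convex_def)
  finally show "weighted_average f w x + 1 / \<zeta> * (gradient (weighted_average f w) x \<bullet> (xs - x))
      \<le> weighted_average f w xs" .
qed

section \<open>Pathwise descent along one sequence of weights\<close>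

lemma sps_ratio_nonneg: "0 \<le> sps_ratio f w x"
  by (simp add: sps_ratio_def)

lemma sps_step_decrease:
  fixes f :: "'n::finite \<Rightarrow> 'a::euclidean_space \<Rightarrow> real"
  assumes "\<And>i x. f i differentiable (at x)" "\<And>i. quasar_convex \<zeta> xs (f i)"
    and "interpolation_at f xs" "\<And>i. 0 \<le> w $ i" "0 < \<zeta>" "0 < c"
  shows "(norm (x - sps_stepsize f c w x *\<^sub>R gradient (weighted_average f w) x - xs))\<^sup>2
    \<le> (norm (x - xs))\<^sup>2 - (2 * c * \<zeta> - 1) / c\<^sup>2 * sps_ratio f w x"
proof -
  define g where "g = gradient (weighted_average f w) x"
  define \<Delta> where "\<Delta> = weighted_average f w x - min_value (weighted_average f w)"
  define s where "s = sps_stepsize f c w x"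
  have s: "s = \<Delta> / (c * (norm g)\<^sup>2)" by (simp add: s_def sps_stepsize_def \<Delta>_def g_def)
  have R: "sps_ratio f w x = \<Delta>\<^sup>2 / (norm g)\<^sup>2" by (simp add: sps_ratio_def \<Delta>_def g_def)
  have min: "xs \<in> global_minimizers (weighted_average f w)"
    by (rule minimizer_weighted_average[OF assms(3,4)])
  have "0 \<le> \<Delta>"
    using min by (simp add: \<Delta>_def min_value_eq) (simp add: global_minimizers_def)
  then have "0 \<le> s" using \<open>0 < c\<close> by (simp add: s)
  \<comment> \<open>Since \<open>xs\<close> attains the minimum, \<open>\<Delta>\<close> is exactly
    the gap appearing in quasar-convexity; multiply that inequality by
    \<open>\<zeta>\<close>.\<close>
  have "\<zeta> * \<Delta> \<le> g \<bullet> (x - xs)"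
    using quasar_convex_weighted_average[OF assms(1,2,4)] \<open>0 < \<zeta>\<close>
    by (auto simp: quasar_convex_def \<Delta>_def g_def min_value_eq[OF min] inner_diff_right field_simps)
  then have "s * (\<zeta> * \<Delta>) \<le> s * (g \<bullet> (x - xs))"
    using \<open>0 \<le> s\<close> by (rule mult_left_mono)
  moreover have "(norm (x - s *\<^sub>R g - xs))\<^sup>2 = (norm (x - xs))\<^sup>2 - 2 * (s * (g \<bullet> (x - xs))) + s\<^sup>2 * (norm g)\<^sup>2"
    unfolding power2_norm_eq_inner power2_eq_square[of s] by (simp add: algebra_simps inner_commute)
  \<comment> \<open>Inserting \<open>s\<close> gives \<open>2 * \<zeta> / c\<close> and
    \<open>1 / c\<^sup>2\<close> times the ratio, whose difference is the stated factor. For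
    \<open>g = 0\<close> both sides are 0 because division by zero yields 0.\<close>
  moreover have "2 * (s * (\<zeta> * \<Delta>)) - s\<^sup>2 * (norm g)\<^sup>2 = (2 * c * \<zeta> - 1) / c\<^sup>2 * (\<Delta>\<^sup>2 / (norm g)\<^sup>2)"
    using \<open>0 < c\<close> by (cases "g = 0") (auto simp: s field_simps power2_eq_square)
  ultimately show ?thesis unfolding R g_def[symmetric] s_def[symmetric] by linarith
qed

text \<open>Both terms on the left are kept because each is used: when the factor is positive,
  dropping the sum confines the iterates to a ball, and dropping the distance bounds the sum of the
  ratios.\<close>

lemma sgd_sps_telescope:
  fixes f :: "'n::finite \<Rightarrow> 'a::euclidean_space \<Rightarrow> real"
  assumes "\<And>i x. f i differentiable (at x)" "\<And>i. quasar_convex \<zeta> xs (f i)"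
    and "interpolation_at f xs" "\<And>k i. 0 \<le> w k $ i" "0 < \<zeta>" "0 < c"
  shows "(norm (sgd_sps f c x0 w k - xs))\<^sup>2
      + (2 * c * \<zeta> - 1) / c\<^sup>2 * (\<Sum>j<k. sps_ratio f (w j) (sgd_sps f c x0 w j))
    \<le> (norm (x0 - xs))\<^sup>2"
proof (induction k)
  case (Suc k)
  show ?case
    using sps_step_decrease[OF assms(1-3) assms(4)[of k] assms(5,6), of "sgd_sps f c x0 w k"] Suc
    by (simp add: Let_def distrib_left)
qed simp

text \<open>The \<open>k\<close>-th iterate sees only the samples before \<open>k\<close>; this is
  what makes it independent of the \<open>k\<close>-th sample.\<close>

lemma sgd_sps_cong:
  "(\<And>j. j < k \<Longrightarrow> w j = w' j) \<Longrightarrow> sgd_sps f c x0 w k = sgd_sps f c x0 w' k"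
  by (induction k) (auto simp: Let_def)

section \<open>Measurability of step sizes, ratios and iterates\<close>

context
  fixes f :: "'n::finite \<Rightarrow> 'a::euclidean_space \<Rightarrow> real"
  assumes diff: "\<And>i x. f i differentiable (at x)"
begin

lemma borel_measurable_objective: "f i \<in> borel_measurable borel"
  using diff by (intro borel_measurable_continuous_onI)
    (simp add: continuous_on_eq_continuous_within differentiable_imp_continuous_within)

lemma borel_measurable_gradient_objective: "gradient (f i) \<in> borel_measurable borel"
  using diff by (rule borel_measurable_gradient)

lemma measurable_weighted_average:
  assumes [measurable]: "W \<in> borel_measurable M" "X \<in> borel_measurable M"
  shows "(\<lambda>\<omega>. weighted_average f (W \<omega>) (X \<omega>)) \<in> borel_measurable M"
proof -
  have [measurable]: "(\<lambda>\<omega>. W \<omega> $ i) \<in> borel_measurable M" "(\<lambda>\<omega>. f i (X \<omega>)) \<in> borel_measurable M" for i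
    using measurable_compose[OF assms(1) borel_measurable_nth]
      measurable_compose[OF assms(2) borel_measurable_objective] by simp_all
  show ?thesis unfolding weighted_average_def by measurable
qed

text \<open>The explicit formula separates weights from points: products of a coordinate of
  \<open>W\<close> with a gradient at \<open>X\<close> give joint measurability.\<close>

lemma measurable_gradient_weighted_average:
  assumes [measurable]: "W \<in> borel_measurable M" "X \<in> borel_measurable M"
  shows "(\<lambda>\<omega>. gradient (weighted_average f (W \<omega>)) (X \<omega>)) \<in> borel_measurable M"
proof -
  have [measurable]: "(\<lambda>\<omega>. W \<omega> $ i) \<in> borel_measurable M"
    "(\<lambda>\<omega>. gradient (f i) (X \<omega>)) \<in> borel_measurable M" for i
    using measurable_compose[OF assms(1) borel_measurable_nth]
      measurable_compose[OF assms(2) borel_measurable_gradient_objective] by simp_all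
  show ?thesis unfolding gradient_weighted_average[OF diff] by measurable
qed

lemma measurable_min_value_weighted_average:
  "(\<lambda>w. min_value (weighted_average f w)) \<in> borel_measurable borel"
  by (rule borel_measurable_min_value) (auto simp: weighted_average_def intro!: continuous_intros)

lemma measurable_sps_stepsize:
  assumes [measurable]: "W \<in> borel_measurable M" "X \<in> borel_measurable M"
  shows "(\<lambda>\<omega>. sps_stepsize f c (W \<omega>) (X \<omega>)) \<in> borel_measurable M"
proof -
  note [measurable] = measurable_weighted_average[OF assms] measurable_gradient_weighted_average[OF assms]
    measurable_compose[OF assms(1) measurable_min_value_weighted_average]
  show ?thesis unfolding sps_stepsize_def by measurable
qed

lemma measurable_sps_ratio:
  assumes [measurable]: "W \<in> borel_measurable M" "X \<in> borel_measurable M"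
  shows "(\<lambda>\<omega>. sps_ratio f (W \<omega>) (X \<omega>)) \<in> borel_measurable M"
proof -
  note [measurable] = measurable_weighted_average[OF assms] measurable_gradient_weighted_average[OF assms]
    measurable_compose[OF assms(1) measurable_min_value_weighted_average]
  show ?thesis unfolding sps_ratio_def by measurable
qed

text \<open>Measurability is asked only of the coordinates below \<open>k\<close>, so that the
  result applies on the finite product space indexed by \<open>{..<k}\<close>.\<close>

lemma measurable_sgd_sps:
  assumes "\<And>j. j < k \<Longrightarrow> (\<lambda>\<omega>. W \<omega> j) \<in> borel_measurable M"
  shows "(\<lambda>\<omega>. sgd_sps f c x0 (W \<omega>) k) \<in> borel_measurable M"
  using assms
proof (induction k)
  case (Suc k)
  then have [measurable]: "(\<lambda>\<omega>. sgd_sps f c x0 (W \<omega>) k) \<in> borel_measurable M"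
    "(\<lambda>\<omega>. W \<omega> k) \<in> borel_measurable M" by auto
  have [measurable]: "(\<lambda>\<omega>. sps_stepsize f c (W \<omega> k) (sgd_sps f c x0 (W \<omega>) k)) \<in> borel_measurable M"
    "(\<lambda>\<omega>. gradient (weighted_average f (W \<omega> k)) (sgd_sps f c x0 (W \<omega>) k)) \<in> borel_measurable M"
    by (rule measurable_sps_stepsize measurable_gradient_weighted_average; fact)+
  show ?case by (simp add: Let_def)
qed simp

end

section \<open>Independence of the iterate from the current sample\<close>

text \<open>The inner integral is over a fresh sample: by independence of \<open>V k\<close> from the \<open>k\<close>-th iterate it
  may be computed with that iterate frozen.\<close>

lemma (in prob_space) sps_ratio_Fubini:
  fixes f :: "'n::finite \<Rightarrow> 'b::euclidean_space \<Rightarrow> real"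
  assumes diff: "\<And>i x. f i differentiable (at x)"
    and indep: "indep_vars (\<lambda>_. borel) V UNIV"
    and distr: "distr M borel (V k) = distr N borel v"
    and v [measurable]: "v \<in> borel_measurable N"
    and int: "integrable M (\<lambda>\<omega>. sps_ratio f (V k \<omega>) (sgd_sps f c x0 (\<lambda>j. V j \<omega>) k))"
  defines "G \<equiv> \<lambda>x. \<integral>u. sps_ratio f (v u) x \<partial>N"
  shows "integrable M (\<lambda>\<omega>. G (sgd_sps f c x0 (\<lambda>j. V j \<omega>) k))"
    and "(\<integral>\<omega>. G (sgd_sps f c x0 (\<lambda>j. V j \<omega>) k) \<partial>M) =
      (\<integral>\<omega>. sps_ratio f (V k \<omega>) (sgd_sps f c x0 (\<lambda>j. V j \<omega>) k) \<partial>M)"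
proof -
  have V [measurable]: "V j \<in> borel_measurable M" for j
    using indep by (auto simp: indep_vars_def)
  define P where "P J = PiM J (\<lambda>_::nat. borel :: (real ^ 'n) measure)" for J
  define Y where "Y J \<omega> = restrict (\<lambda>j. V j \<omega>) J" for J \<omega>
  have Y [measurable]: "Y J \<in> measurable M (P J)" for J
    unfolding Y_def[abs_def] P_def by measurable
  let ?A = "distr M (P {..<k}) (Y {..<k})" and ?B = "distr M (P {k}) (Y {k})"
  \<comment> \<open>The past samples and the current one use disjoint index sets, so their
    restrictions are independent and their joint law is a product measure.\<close>
  have "indep_var (P {..<k}) (Y {..<k}) (P {k}) (Y {k})"
    unfolding P_def Y_def[abs_def] using indep by (rule indep_var_restrict) auto
  then have AB: "?A \<Otimes>\<^sub>M ?B = distr M (P {..<k} \<Otimes>\<^sub>M P {k}) (\<lambda>\<omega>. (Y {..<k} \<omega>, Y {k} \<omega>))"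
    by (simp add: indep_var_distribution_eq)
  interpret A: prob_space ?A by (rule prob_space_distr) simp
  interpret B: prob_space ?B by (rule prob_space_distr) simp
  interpret AB: pair_prob_space ?A ?B ..
  define x where "x a = sgd_sps f c x0 a k" for a
  have x: "x \<in> borel_measurable (P {..<k})"
    unfolding x_def[abs_def] P_def by (rule measurable_sgd_sps[OF diff]) simp
  have k: "(\<lambda>b. b k) \<in> borel_measurable (P {k})"
    unfolding P_def by simp
  have x_Y: "x (Y {..<k} \<omega>) = sgd_sps f c x0 (\<lambda>j. V j \<omega>) k" for \<omega>
    unfolding x_def Y_def by (rule sgd_sps_cong) simp
  have Y_k: "Y {k} \<omega> k = V k \<omega>" for \<omega>
    by (simp add: Y_def)
  define R where "R = (\<lambda>(a, b). sps_ratio f (b k) (x a))"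
  have R [measurable]: "R \<in> borel_measurable (P {..<k} \<Otimes>\<^sub>M P {k})"
    unfolding R_def split_beta'
    by (intro measurable_sps_ratio[OF diff] measurable_compose[OF measurable_fst x]
        measurable_compose[OF measurable_snd k])
  have intR: "integrable (?A \<Otimes>\<^sub>M ?B) R"
  proof -
    have "integrable M (\<lambda>\<omega>. R (Y {..<k} \<omega>, Y {k} \<omega>))"
      using int by (simp add: R_def x_Y Y_k)
    then show ?thesis unfolding AB by (subst integrable_distr_eq) simp_all
  qed
  have G: "G (x a) = (\<integral>b. R (a, b) \<partial>?B)" for a
  proof -
    have ratio: "(\<lambda>w. sps_ratio f w (x a)) \<in> borel_measurable borel"
      by (intro measurable_sps_ratio[OF diff]) simp_all
    \<comment> \<open>Only the law of the sample matters: pass from \<open>v\<close> on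
      \<open>N\<close> to \<open>V k\<close> on \<open>M\<close>, then to the one-coordinate
      product.\<close>
    have "G (x a) = (\<integral>w. sps_ratio f w (x a) \<partial>distr N borel v)"
      unfolding G_def by (rule integral_distr[OF v ratio, symmetric])
    also have "\<dots> = (\<integral>\<omega>. sps_ratio f (V k \<omega>) (x a) \<partial>M)"
      unfolding distr[symmetric] by (rule integral_distr[OF V ratio])
    also have "\<dots> = (\<integral>b. R (a, b) \<partial>?B)"
      by (subst integral_distr[OF Y])
        (simp_all add: R_def Y_k measurable_compose[OF k ratio])
    finally show ?thesis .
  qed
  have int_G: "integrable ?A (\<lambda>a. G (x a))"
    unfolding G by (rule AB.integrable_fst'[OF intR])
  then have "integrable M (\<lambda>\<omega>. G (x (Y {..<k} \<omega>)))"
    by (rule integrable_distr[OF Y])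
  then show "integrable M (\<lambda>\<omega>. G (sgd_sps f c x0 (\<lambda>j. V j \<omega>) k))"
    by (simp add: x_Y)
  have "(\<lambda>a. G (x a)) \<in> borel_measurable (P {..<k})"
    using borel_measurable_integrable[OF int_G] by simp
  then have "(\<integral>\<omega>. G (x (Y {..<k} \<omega>)) \<partial>M) = (\<integral>a. G (x a) \<partial>?A)"
    by (simp add: integral_distr)
  also have "\<dots> = integral\<^sup>L (?A \<Otimes>\<^sub>M ?B) R"
    unfolding G by (rule AB.integral_fst'[OF intR])
  also have "\<dots> = (\<integral>\<omega>. R (Y {..<k} \<omega>, Y {k} \<omega>) \<partial>M)"
    unfolding AB by (subst integral_distr) simp_all
  finally show "(\<integral>\<omega>. G (sgd_sps f c x0 (\<lambda>j. V j \<omega>) k) \<partial>M) =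
      (\<integral>\<omega>. sps_ratio f (V k \<omega>) (sgd_sps f c x0 (\<lambda>j. V j \<omega>) k) \<partial>M)"
    by (simp add: x_Y Y_k R_def)
qed

section \<open>Convergence rate in expectation\<close>

theorem theorem4p4:
  fixes f :: "'n::finite \<Rightarrow> real ^ 'd::finite \<Rightarrow> real"
    and L :: "'n \<Rightarrow> real"
    and xs x0 :: "real ^ 'd"
    and N :: "'u measure" and v :: "'u \<Rightarrow> real ^ 'n"
    and M :: "'w measure" and V :: "nat \<Rightarrow> 'w \<Rightarrow> real ^ 'n"
    and \<zeta> c Lmax :: real
    and K :: nat
  assumes "\<And>i x. f i differentiable (at x)"
    and "sampling_vector N v"
    and "iid_copies M V N v"
    and "xs \<in> global_minimizers (average f)"
    and "interpolation_at f xs"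
    and "0 < \<zeta>" and "\<zeta> \<le> 1"
    and "\<And>i. quasar_convex \<zeta> xs (f i)"
    and "\<And>i. smooth_const (L i) (f i)"
    and "c > 1 / (2 * \<zeta>)"
    and "Lmax > 0"
    and "\<And>x. 1 / (2 * Lmax) * (average f x - min_value (average f))
               \<le> (\<integral>\<omega>. sps_ratio f (v \<omega>) x \<partial>N)"
    and "K \<ge> 1"
  shows "(\<forall>i<K. integrable M (\<lambda>\<omega>. average f (sgd_sps f c x0 (\<lambda>j. V j \<omega>) i) - min_value (average f))) \<and>
         (MIN i\<in>{0..<K}. \<integral>\<omega>. average f (sgd_sps f c x0 (\<lambda>j. V j \<omega>) i) - min_value (average f) \<partial>M)
           \<le> 2 * c\<^sup>2 / (2 * c * \<zeta> - 1) * (Lmax / real K) * (norm (x0 - xs))\<^sup>2"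
proof -
  note diff = assms(1)
  interpret prob_space M using assms(3) by (simp add: iid_copies_def)
  have indep: "indep_vars (\<lambda>_. borel) V UNIV" and distr: "\<And>k. distr M borel (V k) = distr N borel v"
    using assms(3) by (auto simp: iid_copies_def)
  have V [measurable]: "V j \<in> borel_measurable M" for j
    using indep by (auto simp: indep_vars_def)
  have v [measurable]: "v \<in> borel_measurable N" and v_nonneg: "AE u in N. \<forall>i. 0 \<le> v u $ i"
    using assms(2) by (auto simp: sampling_vector_def)
  have [measurable]: "Measurable.pred borel (\<lambda>w::real^'n. \<forall>i. 0 \<le> w $ i)"
    by (intro pred_intros_countable) measurable
  \<comment> \<open>Almost sure nonnegativity is a property of the law, so it passes from
    \<open>v\<close> to every \<open>V k\<close>; countably many null sets are then united.\<close>
  have "AE w in distr N borel v. \<forall>i. 0 \<le> w $ i"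
    using v_nonneg by (subst AE_distr_iff) auto
  then have "AE \<omega> in M. \<forall>i. 0 \<le> V k \<omega> $ i" for k
    unfolding distr[of k, symmetric] by (subst (asm) AE_distr_iff) auto
  then have nonneg: "AE \<omega> in M. \<forall>k i. 0 \<le> V k \<omega> $ i"
    by (simp add: AE_all_countable)
  have "0 < c" using assms(6,10) by (smt (verit) divide_pos_pos)
  \<comment> \<open>The per-step decrease factor; the lower bound on \<open>c\<close> is exactly
    what makes it positive.\<close>
  define \<kappa> where "\<kappa> = (2 * c * \<zeta> - 1) / c\<^sup>2"
  have \<kappa>: "0 < \<kappa>" using assms(6,10) \<open>0 < c\<close> by (simp add: \<kappa>_def field_simps)
  define D where "D = (norm (x0 - xs))\<^sup>2"
  define X where "X k \<omega> = sgd_sps f c x0 (\<lambda>j. V j \<omega>) k" for k \<omega>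
  define R where "R k \<omega> = sps_ratio f (V k \<omega>) (X k \<omega>)" for k \<omega>
  define E where "E k \<omega> = average f (X k \<omega>) - min_value (average f)" for k \<omega>
  have X [measurable]: "X k \<in> borel_measurable M" for k
    unfolding X_def by (rule measurable_sgd_sps[OF diff]) simp
  have R [measurable]: "R k \<in> borel_measurable M" for k
    unfolding R_def by (intro measurable_sps_ratio[OF diff]) simp_all
  have telescope: "AE \<omega> in M. (norm (X k \<omega> - xs))\<^sup>2 + \<kappa> * (\<Sum>j<k. R j \<omega>) \<le> D" for k
    using nonneg
  proof eventually_elim
    case (elim \<omega>)
    then show ?case unfolding X_def R_def \<kappa>_def D_def
      by (intro sgd_sps_telescope diff assms(5,6,8) \<open>0 < c\<close>) auto
  qed
  have R0: "0 \<le> R k \<omega>" for k \<omega> by (simp add: R_def sps_ratio_nonneg)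
  have sumR: "AE \<omega> in M. (\<Sum>j<k. R j \<omega>) \<le> D / \<kappa>" for k
    using telescope[of k]
  proof eventually_elim
    case (elim \<omega>)
    then have "\<kappa> * (\<Sum>j<k. R j \<omega>) \<le> D" by (smt (verit) zero_le_power2)
    then show ?case using \<kappa> by (simp add: field_simps)
  qed
  have intR: "integrable M (R k)" for k
  proof (rule integrable_const_bound)
    \<comment> \<open>The sum up to \<open>Suc k\<close> contains \<open>R k\<close>, and its
      remaining terms are nonnegative, so the bound on the sum also bounds this single term.\<close>
    show "AE \<omega> in M. norm (R k \<omega>) \<le> D / \<kappa>"
      using sumR[of "Suc k"]
    proof eventually_elim
      case (elim \<omega>)
      moreover have "0 \<le> (\<Sum>j<k. R j \<omega>)" by (simp add: sum_nonneg R0)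
      ultimately show ?case using R0[of k \<omega>] by simp
    qed
  qed (rule R)
  have cont: "continuous_on UNIV (average f)"
    unfolding average_def using diff
    by (intro continuous_intros)
      (simp add: continuous_on_eq_continuous_within differentiable_imp_continuous_within)
  have [measurable]: "average f \<in> borel_measurable borel"
    by (rule borel_measurable_continuous_onI[OF cont])
  have intE: "integrable M (E k)" for k
  proof -
    \<comment> \<open>By telescoping, \<open>X k\<close> stays almost surely in this closed ball, on
      which the continuous objective is bounded.\<close>
    have "compact (average f ` cball xs (norm (x0 - xs)))"
      by (intro compact_continuous_image continuous_on_subset[OF cont]) auto
    then have "bounded (average f ` cball xs (norm (x0 - xs)))" by (rule compact_imp_bounded)
    then obtain B where B: "\<And>x. x \<in> cball xs (norm (x0 - xs)) \<Longrightarrow> norm (average f x) \<le> B"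
      by (metis bounded_iff imageI)
    have "integrable M (\<lambda>\<omega>. average f (X k \<omega>))"
    proof (rule integrable_const_bound)
      show "AE \<omega> in M. norm (average f (X k \<omega>)) \<le> B"
        using telescope[of k]
      proof eventually_elim
        case (elim \<omega>)
        moreover have "0 \<le> \<kappa> * (\<Sum>j<k. R j \<omega>)" using \<kappa> by (simp add: sum_nonneg R0)
        ultimately have "(norm (X k \<omega> - xs))\<^sup>2 \<le> (norm (x0 - xs))\<^sup>2"
          unfolding D_def by linarith
        then show ?case by (intro B) (simp add: dist_norm norm_minus_commute)
      qed
    qed measurable
    then show ?thesis unfolding E_def by simp
  qed
  have ER: "(\<integral>\<omega>. E k \<omega> \<partial>M) \<le> 2 * Lmax * (\<integral>\<omega>. R k \<omega> \<partial>M)" for k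
  proof -
    let ?G = "\<lambda>x. \<integral>u. sps_ratio f (v u) x \<partial>N"
    note Fubini = sps_ratio_Fubini[OF diff indep distr v,
        OF intR[unfolded R_def X_def], of k, folded X_def, folded R_def]
    \<comment> \<open>The inequality defining \<open>Lmax\<close> holds at every point, hence at the
      random iterate; Fubini then replaces the fresh sample by \<open>V k\<close>.\<close>
    have "(\<integral>\<omega>. E k \<omega> \<partial>M) \<le> (\<integral>\<omega>. 2 * Lmax * ?G (X k \<omega>) \<partial>M)"
    proof (rule integral_mono[OF intE])
      show "integrable M (\<lambda>\<omega>. 2 * Lmax * ?G (X k \<omega>))" using Fubini(1) by simp
      show "E k \<omega> \<le> 2 * Lmax * ?G (X k \<omega>)" for \<omega>
        using assms(12)[of "X k \<omega>"] assms(11) by (simp add: E_def field_simps)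
    qed
    then show ?thesis using Fubini(2) by simp
  qed
  \<comment> \<open>The minimum of the expected gaps is at most their mean over \<open>K\<close>
    steps.\<close>
  define m where "m = (MIN i\<in>{0..<K}. \<integral>\<omega>. E i \<omega> \<partial>M)"
  have "real K * m = (\<Sum>k<K. m)" by simp
  also have "\<dots> \<le> (\<Sum>k<K. \<integral>\<omega>. E k \<omega> \<partial>M)"
    unfolding m_def by (intro sum_mono Min_le) auto
  also have "\<dots> \<le> (\<Sum>k<K. 2 * Lmax * (\<integral>\<omega>. R k \<omega> \<partial>M))"
    by (intro sum_mono ER)
  also have "\<dots> = 2 * Lmax * (\<integral>\<omega>. (\<Sum>k<K. R k \<omega>) \<partial>M)"
    using intR by (simp add: sum_distrib_left)
  also have "\<dots> \<le> 2 * Lmax * (D / \<kappa>)"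
  proof (intro mult_left_mono)
    have "(\<integral>\<omega>. (\<Sum>k<K. R k \<omega>) \<partial>M) \<le> (\<integral>\<omega>. D / \<kappa> \<partial>M)"
      using intR sumR by (intro integral_mono_AE) auto
    then show "(\<integral>\<omega>. (\<Sum>k<K. R k \<omega>) \<partial>M) \<le> D / \<kappa>" by (simp add: prob_space)
  qed (use assms(11) in simp)
  finally have "m \<le> 2 * Lmax * (D / \<kappa>) / real K"
    using assms(13) by (subst pos_le_divide_eq) (simp_all add: mult.commute)
  also have "\<dots> = 2 * c\<^sup>2 / (2 * c * \<zeta> - 1) * (Lmax / real K) * D"
    by (simp add: \<kappa>_def)
  finally show ?thesis
    using intE unfolding m_def E_def X_def D_def by blast
qed

end
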